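(* Let $f,g:(0,\infty)\to(0,\infty)$ be continuous strictly increasing functions such that the function $\frac{f}{g}$ is strictly increasing. Then: (i) the functions $M,N:(0,\infty)^2\to(0,\infty)$ given by $$M(x,y):=f^{-1}\left(\frac{g(y)}{g(x)}f(x)\right),\qquad N(x,y):=f^{-1}\left(\frac{g(x)}{g(y)}f(y)\right)$$ are generalized weighted quasi-geometric means, as $M=G_{\frac{f}{g},g}$ and $N=G_{g,\frac{f}{g}}$; (ii) the quasi-geometric mean $G_f:(0,\infty)^2\to(0,\infty)$ given by $$G_f(x,y)=f^{-1}\left(\sqrt{f(x)f(y)}\right)$$ is invariant with respect to the mean-type mapping $(M,N)$, i.e. $G_f\circ(M,N)=G_f$; (iii) the sequence $\left((M,N)^n:n\in\mathbb{N}\right)$ of iterates of the mean-type mapping $(M,N):(0,\infty)^2\to(0,\infty)^2$ converges uniformly on compact subsets of $(0,\infty)^2$ and $$\lim_{n\to\infty}(M,N)^n=(G_f,G_f);$$ (iv) a continuous function $\Phi:(0,\infty)^2\to\mathbb{R}$ is invariant with respect to the mean-type mapping $(M,N)$, i.e. $\Phi$ satisfies the equation $$\Phi\left(M(x,y),N(x,y)\right)=\Phi(x,y),\qquad x,y>0,$$ if and only if there is a continuous single variable function $\varphi:(0,\infty)\to\mathbb{R}$ such that $$\Phi(x,y)=\varphi\left(G_f(x,y)\right),\qquad x,y>0.$$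
   Context: Let $I\subset\mathbb{R}$ be an interval. If $\varphi,\psi:I\to(0,\infty)$ are continuous and both strictly increasing or both strictly decreasing, the generalized weighted quasi-geometric mean in $I$ of generators $\varphi$ and $\psi$ is the function $G_{\varphi,\psi}:I^2\to I$ defined by $$G_{\varphi,\psi}(x,y):=(\varphi\cdot\psi)^{-1}\left(\varphi(x)\psi(y)\right),$$ where $\varphi\cdot\psi$ is the pointwise product and $(\varphi\cdot\psi)^{-1}$ its inverse function. Here $I=(0,\infty)$. $(M,N)$ denotes the mapping $(x,y)\mapsto(M(x,y),N(x,y))$, $(M,N)^n$ its $n$th iterate under composition, and $f^{-1}$ the inverse function of $f$ (defined on the range of $f$). *)

theory Defs
  imports "HOL-Analysis.Analysis"
begin

text \<open>Functions on an interval \<open>I\<close> are represented by total functions on the reals, only their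
  values on \<open>I\<close> being relevant. The inverse of an injective function \<open>h\<close> on \<open>I\<close>, defined on
  \<open>h ` I\<close>, is \<^term>\<open>the_inv_into I h\<close>; it is unspecified outside \<open>h ` I\<close>.\<close>

definition gwqg_generators :: "real set \<Rightarrow> (real \<Rightarrow> real) \<Rightarrow> (real \<Rightarrow> real) \<Rightarrow> bool" where
  "gwqg_generators I \<phi> \<psi> \<longleftrightarrow>
     is_interval I \<and> continuous_on I \<phi> \<and> continuous_on I \<psi> \<and>
     (\<forall>x\<in>I. 0 < \<phi> x \<and> 0 < \<psi> x) \<and>
     (strict_mono_on I \<phi> \<and> strict_mono_on I \<psi> \<or>
      strict_antimono_on I \<phi> \<and> strict_antimono_on I \<psi>)"

text \<open>The generalized weighted quasi-geometric mean in \<open>I\<close> of generators \<open>\<phi>\<close> and \<open>\<psi>\<close>, meaningful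
  when \<^term>\<open>gwqg_generators I \<phi> \<psi>\<close> holds.\<close>

definition gwqg_mean ::
    "real set \<Rightarrow> (real \<Rightarrow> real) \<Rightarrow> (real \<Rightarrow> real) \<Rightarrow> real \<Rightarrow> real \<Rightarrow> real" where
  "gwqg_mean I \<phi> \<psi> x y = the_inv_into I (\<lambda>t. \<phi> t * \<psi> t) (\<phi> x * \<psi> y)"

definition qg_mean :: "real set \<Rightarrow> (real \<Rightarrow> real) \<Rightarrow> real \<Rightarrow> real \<Rightarrow> real" where
  "qg_mean I f x y = the_inv_into I f (sqrt (f x * f y))"

text \<open>The mapping \<open>(M, N)\<close>.\<close>

definition pair_map ::
    "(real \<Rightarrow> real \<Rightarrow> real) \<Rightarrow> (real \<Rightarrow> real \<Rightarrow> real) \<Rightarrow> real \<times> real \<Rightarrow> real \<times> real" where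
  "pair_map M N = (\<lambda>(x, y). (M x y, N x y))"

end

theory Submission
  imports Defs
begin

text \<open>\<open>M\<close> and \<open>N\<close> are strict means, so \<open>(M, N)\<close> strictly decreases the distance \<open>\<bar>x - y\<bar>\<close> off the
  diagonal and leaves every square \<open>[a, b]\<^sup>2\<close> invariant. On the compact part of the square where
  \<open>\<bar>x - y\<bar> \<ge> \<epsilon>\<close> the decrease is bounded below by a positive constant, so after boundedly many steps
  all orbits are \<open>\<epsilon>\<close>-close to the diagonal. Since \<open>f (M x y) * f (N x y) = f x * f y\<close>, the mean \<open>G\<^sub>f\<close> is
  invariant, hence it lies between the two coordinates of every iterate and is the common limit. An
  invariant continuous \<open>\<Phi>\<close> is constant along orbits and so agrees with its value at the limit
  \<open>(G\<^sub>f, G\<^sub>f)\<close>.\<close>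

section \<open>Means and strict means on an interval\<close>

definition mean_on :: "real set \<Rightarrow> (real \<Rightarrow> real \<Rightarrow> real) \<Rightarrow> bool" where
  "mean_on I G \<longleftrightarrow> (\<forall>x\<in>I. \<forall>y\<in>I. G x y \<in> {min x y..max x y})"

text \<open>Strictness can be asked only off the diagonal, where the open interval is nonempty; on
  the diagonal \<open>mean_on\<close> forces \<open>G x x = x\<close>.\<close>

definition strict_mean_on :: "real set \<Rightarrow> (real \<Rightarrow> real \<Rightarrow> real) \<Rightarrow> bool" where
  "strict_mean_on I G \<longleftrightarrow>
     mean_on I G \<and> (\<forall>x\<in>I. \<forall>y\<in>I. x \<noteq> y \<longrightarrow> G x y \<in> {min x y<..<max x y})"

lemma mean_onD: "mean_on I G \<Longrightarrow> x \<in> I \<Longrightarrow> y \<in> I \<Longrightarrow> min x y \<le> G x y \<and> G x y \<le> max x y"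
  by (simp add: mean_on_def)

lemma mean_on_idem: "mean_on I G \<Longrightarrow> x \<in> I \<Longrightarrow> G x x = x"
  using mean_onD[of I G x x] by simp

lemma mean_on_mem:
  assumes "mean_on I G" "is_interval I" "x \<in> I" "y \<in> I"
  shows "G x y \<in> I"
proof -
  have "min x y \<in> I" "max x y \<in> I"
    using assms by (auto simp: min_def max_def)
  then show ?thesis
    using assms mean_onD[OF assms(1,3,4)] by (meson mem_is_interval_1_I)
qed

lemma mean_on_subset: "mean_on I G \<Longrightarrow> J \<subseteq> I \<Longrightarrow> mean_on J G"
  by (auto simp: mean_on_def)

lemma strict_mean_on_subset: "strict_mean_on I G \<Longrightarrow> J \<subseteq> I \<Longrightarrow> strict_mean_on J G"
  by (auto simp: strict_mean_on_def mean_on_subset subset_iff)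

lemma strict_mean_on_contraction:
  assumes "strict_mean_on I M" "strict_mean_on I N" "x \<in> I" "y \<in> I" "x \<noteq> y"
  shows "\<bar>M x y - N x y\<bar> < \<bar>x - y\<bar>"
proof -
  have "M x y \<in> {min x y<..<max x y}" "N x y \<in> {min x y<..<max x y}"
    using assms by (auto simp: strict_mean_on_def)
  then show ?thesis by (auto simp: min_def max_def split: if_splits)
qed

section \<open>Uniform decay of the coordinate gap under iteration\<close>

lemma pair_map_iterate_mem:
  assumes "mean_on I M" "mean_on I N" "is_interval I" "p \<in> I \<times> I"
  shows "(pair_map M N ^^ n) p \<in> I \<times> I"
  using assms(4)
  by (induction n) (auto simp: pair_map_def mean_on_mem[OF assms(1,3)] mean_on_mem[OF assms(2,3)])

text \<open>The quantifier over \<open>p\<close> stands inside the eventuality: one threshold serves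
  the whole square, and this is the source of uniformity in the convergence result.\<close>

lemma iterate_gap_uniformly_small:
  fixes M N :: "real \<Rightarrow> real \<Rightarrow> real"
  defines "gap \<equiv> \<lambda>p :: real \<times> real. \<bar>fst p - snd p\<bar>"
  assumes M: "strict_mean_on {a..b} M" and N: "strict_mean_on {a..b} N"
    and cont: "continuous_on ({a..b} \<times> {a..b}) (pair_map M N)"
    and e: "0 < e"
  shows "\<forall>\<^sub>F n in sequentially. \<forall>p\<in>{a..b} \<times> {a..b}. gap ((pair_map M N ^^ n) p) < e"
proof -
  define T where "T = pair_map M N"
  define S where "S = {a..b} \<times> {a..b}"
  define C where "C = {p \<in> S. e \<le> gap p}"
  have contT: "continuous_on S T"
    using cont by (simp add: S_def T_def)
  have contgap: "continuous_on X gap" for X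
    unfolding gap_def by (intro continuous_intros)
  have TS: "T p \<in> S" if "p \<in> S" for p
    using pair_map_iterate_mem[of "{a..b}" M N p 1] that M N
    by (simp add: T_def S_def strict_mean_on_def is_interval_cc)
  have TnS: "(T ^^ n) p \<in> S" if "p \<in> S" for n p
    using that by (induction n) (auto simp: TS)
  have less: "gap (T p) < gap p" if "p \<in> S" "gap p > 0" for p
    using that strict_mean_on_contraction[OF M N, of "fst p" "snd p"]
    by (auto simp: gap_def T_def S_def pair_map_def split: prod.splits)
  \<comment> \<open>Points of the diagonal are fixed by \<open>T\<close>, so the gap never grows
    anywhere on the square.\<close>
  have le: "gap (T p) \<le> gap p" if "p \<in> S" for p
  proof (cases "gap p > 0")
    case True
    then show ?thesis using less[OF that] by simp
  next
    case False
    then obtain x where p: "p = (x, x)" by (cases p) (auto simp: gap_def)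
    then have "M x x = x" "N x x = x"
      using that M N by (auto simp: S_def strict_mean_on_def intro: mean_on_idem)
    then show ?thesis by (simp add: p gap_def T_def pair_map_def)
  qed
  have "compact S"
    unfolding S_def by (intro compact_Times compact_Icc)
  moreover have "closed {p. e \<le> gap p}"
    by (intro closed_Collect_le contgap continuous_on_const)
  ultimately have "compact C"
    unfolding C_def by (metis Collect_conj_eq Collect_mem_eq compact_Int_closed)
  have contC: "continuous_on C (\<lambda>p. gap p - gap (T p))"
  proof (intro continuous_intros contgap)
    show "continuous_on C (\<lambda>p. gap (T p))"
      using continuous_on_compose2[OF contgap[of UNIV] continuous_on_subset[OF contT, of C]]
      by (auto simp: C_def)
  qed
  \<comment> \<open>If \<open>C\<close> is empty, any positive number serves; otherwise \<delta> is
    the minimum over the compact set \<open>C\<close> of the decrease in one step, positive because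
    the gap is at least \<open>e > 0\<close> there.\<close>
  obtain \<delta> where \<delta>: "\<delta> > 0" "\<And>p. p \<in> C \<Longrightarrow> gap (T p) \<le> gap p - \<delta>"
  proof (cases "C = {}")
    case True
    then show ?thesis using that[of 1] by simp
  next
    case False
    then obtain q where q: "q \<in> C" "\<And>p. p \<in> C \<Longrightarrow> gap q - gap (T q) \<le> gap p - gap (T p)"
      using continuous_attains_inf[OF \<open>compact C\<close> _ contC] by blast
    have "0 < gap q - gap (T q)"
      using q(1) less[of q] e by (auto simp: C_def)
    then show ?thesis
      using that[of "gap q - gap (T q)"] q(2) by force
  qed
  \<comment> \<open>Only the last iterate is assumed to have gap at least \<open>e\<close>. As the
    gap never grows, all earlier iterates have it too, so they lie in \<open>C\<close> and each step
    loses at least \<delta>.\<close>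
  have descent: "gap ((T ^^ n) p) \<le> gap p - real n * \<delta>" if "p \<in> S" "e \<le> gap ((T ^^ n) p)" for n p
    using that(2)
  proof (induction n)
    case (Suc n)
    let ?q = "(T ^^ n) p"
    have "e \<le> gap ?q"
      using Suc.prems le[OF TnS[OF that(1), of n]] by simp
    then have "gap (T ?q) \<le> gap ?q - \<delta>" "gap ?q \<le> gap p - real n * \<delta>"
      using \<delta>(2) TnS[OF that(1)] Suc.IH by (auto simp: C_def)
    then show ?case by (simp add: algebra_simps)
  qed simp
  \<comment> \<open>The initial gap is at most \<open>b - a\<close>, so from \<open>n0\<close> steps
    on a total loss of \<open>n * \<delta>\<close> would make the gap negative.\<close>
  obtain n0 :: nat where n0: "(b - a) / \<delta> < real n0"
    using reals_Archimedean2 by blast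
  have "gap ((T ^^ n) p) < e" if "n0 \<le> n" "p \<in> S" for n p
  proof (rule ccontr)
    assume "\<not> gap ((T ^^ n) p) < e"
    then have "e \<le> gap p - real n * \<delta>"
      using descent[of p n] that by simp
    moreover have "gap p \<le> b - a"
      using that by (auto simp: S_def gap_def)
    moreover have "(b - a) / \<delta> < real n" using n0 that(1) by linarith
    then have "b - a < real n * \<delta>"
      using \<delta>(1) by (simp add: pos_divide_less_eq)
    ultimately show False using e by linarith
  qed
  then show ?thesis
    unfolding eventually_sequentially T_def S_def by blast
qed

section \<open>Locally uniform convergence and invariant functions\<close>

lemma compact_subset_square:
  fixes K :: "(real \<times> real) set"
  assumes "compact K" "K \<subseteq> I \<times> I" "K \<noteq> {}"
  obtains a b where "a \<in> I" "b \<in> I" "K \<subseteq> {a..b} \<times> {a..b}"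
proof -
  let ?L = "fst ` K \<union> snd ` K"
  have L: "compact ?L" "?L \<noteq> {}"
    using assms compact_continuous_image[OF continuous_on_fst[OF continuous_on_id] assms(1)]
      compact_continuous_image[OF continuous_on_snd[OF continuous_on_id] assms(1)] by (simp_all add: compact_Un)
  \<comment> \<open>The extrema are attained, so \<open>a\<close> and \<open>b\<close> are
    coordinates of points of \<open>K\<close> and belong to \<open>I\<close> even when
    \<open>I\<close> is open.\<close>
  obtain a where a: "a \<in> ?L" "\<forall>t\<in>?L. a \<le> t"
    using compact_attains_inf[OF L] by blast
  obtain b where b: "b \<in> ?L" "\<forall>t\<in>?L. t \<le> b"
    using compact_attains_sup[OF L] by blast
  have "?L \<subseteq> I" using assms(2) by auto
  moreover have "K \<subseteq> {a..b} \<times> {a..b}"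
  proof
    fix p assume "p \<in> K"
    then have "fst p \<in> ?L" "snd p \<in> ?L" by auto
    then show "p \<in> {a..b} \<times> {a..b}" using a(2) b(2) by (simp add: mem_Times_iff)
  qed
  ultimately show ?thesis using that a(1) b(1) by blast
qed

text \<open>The decay of the gap drives the iterates to the diagonal, and any invariant mean
  \<open>G\<close> then identifies the limit; no formula for \<open>M\<close> and \<open>N\<close>
  enters.\<close>

lemma uniform_limit_mean_type_iterates:
  assumes I: "is_interval I"
    and M: "strict_mean_on I M" and N: "strict_mean_on I N" and G: "mean_on I G"
    and cont: "continuous_on (I \<times> I) (pair_map M N)"
    and inv: "\<And>x y. x \<in> I \<Longrightarrow> y \<in> I \<Longrightarrow> G (M x y) (N x y) = G x y"
    and K: "compact K" "K \<subseteq> I \<times> I"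
  shows "uniform_limit K (\<lambda>n. pair_map M N ^^ n) (pair_map G G) sequentially"
proof (cases "K = {}")
  case True
  then show ?thesis by (simp add: uniform_limit_iff)
next
  case False
  obtain a b where ab: "a \<in> I" "b \<in> I" "K \<subseteq> {a..b} \<times> {a..b}"
    using compact_subset_square[OF K False] .
  have sub: "{a..b} \<subseteq> I"
    using ab(1,2) I by (meson atLeastAtMost_iff mem_is_interval_1_I subsetI)
  define T where "T = pair_map M N"
  have mem: "(T ^^ n) p \<in> I \<times> I" if "p \<in> I \<times> I" for n p
    using pair_map_iterate_mem[OF _ _ I that] M N by (simp add: T_def strict_mean_on_def)
  have invn: "case_prod G ((T ^^ n) p) = case_prod G p" if "p \<in> I \<times> I" for n p
  proof (induction n)
    case (Suc n)
    then show ?case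
      using mem[OF that, of n] inv by (auto simp: T_def pair_map_def split: prod.splits)
  qed simp
  \<comment> \<open>The invariant value \<open>G x y\<close> lies between the coordinates of the
    iterate, so each coordinate is within the gap of it. The Euclidean distance is at most the sum
    of the two deviations, whence the factor 2.\<close>
  have near: "dist ((T ^^ n) p) (pair_map G G p) \<le> 2 * \<bar>fst ((T ^^ n) p) - snd ((T ^^ n) p)\<bar>"
    if "p \<in> I \<times> I" for n p
  proof -
    obtain u v where uv: "(T ^^ n) p = (u, v)" by fastforce
    obtain x y where p: "p = (x, y)" by fastforce
    have "G u v = G x y" using invn[OF that, of n] uv p by simp
    moreover have "min u v \<le> G u v \<and> G u v \<le> max u v"
      using mean_onD[OF G] mem[OF that, of n] uv by auto
    ultimately have "\<bar>u - G x y\<bar> \<le> \<bar>u - v\<bar>" "\<bar>v - G x y\<bar> \<le> \<bar>u - v\<bar>" by auto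
    moreover have "dist (u, v) (G x y, G x y) \<le> \<bar>u - G x y\<bar> + \<bar>v - G x y\<bar>"
      by (simp add: dist_Pair_Pair dist_real_def sqrt_sum_squares_le_sum_abs[of "u - G x y" "v - G x y", simplified])
    ultimately show ?thesis using uv p by (simp add: pair_map_def)
  qed
  show ?thesis
  proof (rule uniform_limitI)
    fix e :: real assume "0 < e"
    have "\<forall>\<^sub>F n in sequentially. \<forall>p\<in>{a..b} \<times> {a..b}.
        \<bar>fst ((T ^^ n) p) - snd ((T ^^ n) p)\<bar> < e / 2"
      unfolding T_def using \<open>0 < e\<close> sub
      by (intro iterate_gap_uniformly_small strict_mean_on_subset[OF M]
          strict_mean_on_subset[OF N] continuous_on_subset[OF cont]) auto
    then show "\<forall>\<^sub>F n in sequentially. \<forall>p\<in>K. dist ((pair_map M N ^^ n) p) (pair_map G G p) < e"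
      unfolding T_def[symmetric]
    proof eventually_elim
      case (elim n)
      show ?case
      proof
        fix p assume "p \<in> K"
        then show "dist ((T ^^ n) p) (pair_map G G p) < e"
          using near[of p n] elim ab(3) K(2) by force
      qed
    qed
  qed
qed

text \<open>The witness for \<phi> is the restriction of \<Phi> to the diagonal, where the orbits
  end. The codomain is Hausdorff so that the limit of \<Phi> along an orbit is unique. Conversely, a
  function of \<open>G\<close> inherits the invariance of \<open>G\<close>.\<close>

lemma invariant_iff_function_of_mean:
  fixes \<Phi> :: "real \<times> real \<Rightarrow> 'a::t2_space"
  assumes I: "is_interval I"
    and M: "strict_mean_on I M" and N: "strict_mean_on I N" and G: "mean_on I G"
    and cont: "continuous_on (I \<times> I) (pair_map M N)"
    and inv: "\<And>x y. x \<in> I \<Longrightarrow> y \<in> I \<Longrightarrow> G (M x y) (N x y) = G x y"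
    and \<Phi>: "continuous_on (I \<times> I) \<Phi>"
  shows "(\<forall>x\<in>I. \<forall>y\<in>I. \<Phi> (M x y, N x y) = \<Phi> (x, y)) \<longleftrightarrow>
    (\<exists>\<phi>. continuous_on I \<phi> \<and> (\<forall>x\<in>I. \<forall>y\<in>I. \<Phi> (x, y) = \<phi> (G x y)))"
proof
  assume *: "\<forall>x\<in>I. \<forall>y\<in>I. \<Phi> (M x y, N x y) = \<Phi> (x, y)"
  define T where "T = pair_map M N"
  have mem: "(T ^^ n) p \<in> I \<times> I" if "p \<in> I \<times> I" for n p
    using pair_map_iterate_mem[OF _ _ I that] M N by (simp add: T_def strict_mean_on_def)
  have \<Phi>n: "\<Phi> ((T ^^ n) p) = \<Phi> p" if "p \<in> I \<times> I" for n p
  proof (induction n)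
    case (Suc n)
    then show ?case
      using mem[OF that, of n] * by (auto simp: T_def pair_map_def split: prod.splits)
  qed simp
  have "\<Phi> (x, y) = \<Phi> (G x y, G x y)" if xy: "x \<in> I" "y \<in> I" for x y
  proof -
    \<comment> \<open>A singleton is compact, so the uniform statement yields convergence at one
      point.\<close>
    have "uniform_limit {(x, y)} (\<lambda>n. T ^^ n) (pair_map G G) sequentially"
      unfolding T_def using xy
      by (intro uniform_limit_mean_type_iterates[where I = I and M = M and N = N and G = G] I M N G cont inv)
        auto
    then have "(\<lambda>n. (T ^^ n) (x, y)) \<longlonglongrightarrow> pair_map G G (x, y)"
      by (rule tendsto_uniform_limitI) simp
    then have "(\<lambda>n. \<Phi> ((T ^^ n) (x, y))) \<longlonglongrightarrow> \<Phi> (G x y, G x y)"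
      using xy mean_on_mem[OF G I xy] mem[of "(x, y)"]
      by (intro continuous_on_tendsto_compose[OF \<Phi>]) (auto simp: pair_map_def)
    moreover have "(\<lambda>n. \<Phi> ((T ^^ n) (x, y))) \<longlonglongrightarrow> \<Phi> (x, y)"
      using xy by (simp add: \<Phi>n)
    ultimately show ?thesis using LIMSEQ_unique by metis
  qed
  moreover have "continuous_on I (\<lambda>t. \<Phi> (t, t))"
    by (rule continuous_on_compose2[OF \<Phi> continuous_on_Pair[OF continuous_on_id continuous_on_id]]) auto
  ultimately show "\<exists>\<phi>. continuous_on I \<phi> \<and> (\<forall>x\<in>I. \<forall>y\<in>I. \<Phi> (x, y) = \<phi> (G x y))"
    by (intro exI[of _ "\<lambda>t. \<Phi> (t, t)"]) blast
next
  assume "\<exists>\<phi>. continuous_on I \<phi> \<and> (\<forall>x\<in>I. \<forall>y\<in>I. \<Phi> (x, y) = \<phi> (G x y))"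
  then obtain \<phi> where \<phi>: "\<And>x y. x \<in> I \<Longrightarrow> y \<in> I \<Longrightarrow> \<Phi> (x, y) = \<phi> (G x y)"
    by blast
  have "M x y \<in> I" "N x y \<in> I" if "x \<in> I" "y \<in> I" for x y
    using M N that mean_on_mem[OF _ I] by (auto simp: strict_mean_on_def)
  then show "\<forall>x\<in>I. \<forall>y\<in>I. \<Phi> (M x y, N x y) = \<Phi> (x, y)"
    by (simp add: \<phi> inv)
qed

section \<open>Inverses on an interval and values between \<open>f x\<close> and
  \<open>f y\<close>\<close>

lemma continuous_on_the_inv_into_interval:
  fixes f :: "real \<Rightarrow> real"
  assumes "is_interval I" "continuous_on I f" "inj_on f I"
  shows "continuous_on (f ` I) (the_inv_into I f)"
proof -
  have "path_connected I"
    using assms(1) is_interval_path_connected_1 by blast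
  \<comment> \<open>A continuous injection on an interval is a homeomorphism onto its image; its
    inverse \<open>h\<close> agrees there with \<open>the_inv_into I f\<close>.\<close>
  then obtain h where "homeomorphism I (f ` I) f h"
    using injective_into_1d_eq_homeomorphism[OF assms(2)] assms(3) by blast
  then have "continuous_on (f ` I) h" "\<And>z. z \<in> f ` I \<Longrightarrow> the_inv_into I f z = h z"
    using assms(3) by (auto simp: homeomorphism_def the_inv_into_f_f)
  then show ?thesis by (simp cong: continuous_on_cong)
qed

text \<open>This is the intermediate value theorem, by connectedness of the image. It guarantees
  that \<open>the_inv_into\<close> is applied only where it is a genuine inverse.\<close>

lemma mem_image_between:
  fixes f :: "real \<Rightarrow> real"
  assumes "is_interval I" "continuous_on I f" "x \<in> I" "y \<in> I"
    and "z \<in> {min (f x) (f y)..max (f x) (f y)}"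
  shows "z \<in> f ` I"
proof -
  have "is_interval (f ` I)"
    using assms by (simp add: is_interval_connected_1 connected_continuous_image)
  moreover have "min (f x) (f y) \<in> f ` I" "max (f x) (f y) \<in> f ` I"
    using assms by (auto simp: min_def max_def)
  ultimately show ?thesis
    using assms(5) by (meson atLeastAtMost_iff mem_is_interval_1_I)
qed

text \<open>Writing \<open>z = f t\<close> reduces both claims to comparing \<open>t\<close> with
  \<open>x\<close> and \<open>y\<close>, since \<open>f\<close> preserves and reflects order. The
  closed form yields means, the open form strict means.\<close>

lemma the_inv_into_between:
  fixes f :: "real \<Rightarrow> real"
  assumes "strict_mono_on I f" "x \<in> I" "y \<in> I" "z \<in> f ` I"
  shows "z \<in> {min (f x) (f y)..max (f x) (f y)} \<Longrightarrow> the_inv_into I f z \<in> {min x y..max x y}"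
    and "z \<in> {min (f x) (f y)<..<max (f x) (f y)} \<Longrightarrow> the_inv_into I f z \<in> {min x y<..<max x y}"
proof -
  obtain t where t: "t \<in> I" "z = f t" "the_inv_into I f z = t"
    using assms(4) the_inv_into_f_f[OF strict_mono_on_imp_inj_on[OF assms(1)]] by blast
  note cmp = strict_mono_on_less_eq[OF assms(1)] strict_mono_on_less[OF assms(1)]
  show "z \<in> {min (f x) (f y)..max (f x) (f y)} \<Longrightarrow> the_inv_into I f z \<in> {min x y..max x y}"
    using t assms(2,3) by (auto simp: min_le_iff_disj le_max_iff_disj cmp)
  show "z \<in> {min (f x) (f y)<..<max (f x) (f y)} \<Longrightarrow> the_inv_into I f z \<in> {min x y<..<max x y}"
    using t assms(2,3) by (auto simp: min_less_iff_disj less_max_iff_disj cmp)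
qed

text \<open>With \<open>h = f / g\<close> the weighted value is \<open>h x * g y\<close>, while
  \<open>f x = h x * g x\<close> and \<open>f y = h y * g y\<close>. Both factors are positive and
  increasing, so replacing one of them moves the product towards the other endpoint without reaching
  it.\<close>

lemma ratio_weighted_between:
  fixes f g :: "real \<Rightarrow> real"
  assumes pos: "\<And>x. x \<in> I \<Longrightarrow> 0 < f x" "\<And>x. x \<in> I \<Longrightarrow> 0 < g x"
    and mono: "strict_mono_on I g" "strict_mono_on I (\<lambda>x. f x / g x)"
    and xy: "x \<in> I" "y \<in> I"
  shows "g y / g x * f x \<in> {min (f x) (f y)..max (f x) (f y)}"
    and "x \<noteq> y \<Longrightarrow> g y / g x * f x \<in> {min (f x) (f y)<..<max (f x) (f y)}"
proof -
  \<comment> \<open>\<open>up\<close> treats \<open>x < y\<close> and \<open>down\<close> treats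
    \<open>y < x\<close>, with \<open>u\<close> the smaller argument in both.\<close>
  have up: "f u < g v / g u * f u" "g v / g u * f u < f v"
    if "u \<in> I" "v \<in> I" "u < v" for u v
  proof -
    have "g u < g v" "f u / g u < f v / g v"
      using that mono by (auto simp: strict_mono_on_def)
    then show "f u < g v / g u * f u" "g v / g u * f u < f v"
      using pos that by (simp_all add: field_simps)
  qed
  have down: "f u < g u / g v * f v" "g u / g v * f v < f v"
    if "u \<in> I" "v \<in> I" "u < v" for u v
  proof -
    have "g u < g v" "f u / g u < f v / g v"
      using that mono by (auto simp: strict_mono_on_def)
    then show "f u < g u / g v * f v" "g u / g v * f v < f v"
      using pos that by (simp_all add: field_simps)
  qed
  show strict: "g y / g x * f x \<in> {min (f x) (f y)<..<max (f x) (f y)}" if "x \<noteq> y"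
    using that xy up[of x y] down[of y x] by (cases "x < y") auto
  show "g y / g x * f x \<in> {min (f x) (f y)..max (f x) (f y)}"
    using strict pos(2)[OF xy(1)] by (cases "x = y") auto
qed

lemma sqrt_mult_between:
  assumes "0 < a" "0 < b"
  shows "sqrt (a * b) \<in> {min a b..max a b}"
proof -
  have "sqrt (min a b * min a b) \<le> sqrt (a * b)" "sqrt (a * b) \<le> sqrt (max a b * max a b)"
    using assms by (intro real_sqrt_le_mono mult_mono; simp)+
  then show ?thesis using assms by simp
qed

section \<open>Application to the generators \<open>f / g\<close> and \<open>g\<close>\<close>

theorem theorem5:
  fixes f g :: "real \<Rightarrow> real" and M N :: "real \<Rightarrow> real \<Rightarrow> real"
  assumes f_pos: "\<And>x. 0 < x \<Longrightarrow> 0 < f x"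
    and g_pos: "\<And>x. 0 < x \<Longrightarrow> 0 < g x"
    and f_cont: "continuous_on {0<..} f"
    and g_cont: "continuous_on {0<..} g"
    and f_mono: "strict_mono_on {0<..} f"
    and g_mono: "strict_mono_on {0<..} g"
    and fg_mono: "strict_mono_on {0<..} (\<lambda>x. f x / g x)"
    and M_eq: "\<And>x y. 0 < x \<Longrightarrow> 0 < y \<Longrightarrow> M x y = the_inv_into {0<..} f (g y / g x * f x)"
    and N_eq: "\<And>x y. 0 < x \<Longrightarrow> 0 < y \<Longrightarrow> N x y = the_inv_into {0<..} f (g x / g y * f y)"
  shows
    "(\<forall>x>0. \<forall>y>0. g y / g x * f x \<in> f ` {0<..} \<and> g x / g y * f y \<in> f ` {0<..} \<and>
        0 < M x y \<and> 0 < N x y) \<and>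
     gwqg_generators {0<..} (\<lambda>t. f t / g t) g \<and>
     gwqg_generators {0<..} g (\<lambda>t. f t / g t) \<and>
     (\<forall>x>0. \<forall>y>0. M x y = gwqg_mean {0<..} (\<lambda>t. f t / g t) g x y \<and>
                  N x y = gwqg_mean {0<..} g (\<lambda>t. f t / g t) x y) \<and>
     (\<forall>x>0. \<forall>y>0. sqrt (f x * f y) \<in> f ` {0<..} \<and> 0 < qg_mean {0<..} f x y) \<and>
     (\<forall>x>0. \<forall>y>0. qg_mean {0<..} f (M x y) (N x y) = qg_mean {0<..} f x y) \<and>
     (\<forall>K. compact K \<and> K \<subseteq> {0<..} \<times> {0<..} \<longrightarrow>
        uniform_limit K (\<lambda>n. pair_map M N ^^ n)
          (pair_map (qg_mean {0<..} f) (qg_mean {0<..} f)) sequentially) \<and>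
     (\<forall>\<Phi> :: real \<times> real \<Rightarrow> real. continuous_on ({0<..} \<times> {0<..}) \<Phi> \<longrightarrow>
        ((\<forall>x>0. \<forall>y>0. \<Phi> (M x y, N x y) = \<Phi> (x, y)) \<longleftrightarrow>
         (\<exists>\<phi> :: real \<Rightarrow> real. continuous_on {0<..} \<phi> \<and>
            (\<forall>x>0. \<forall>y>0. \<Phi> (x, y) = \<phi> (qg_mean {0<..} f x y)))))"
proof -
  let ?I = "{0<..} :: real set"
  let ?F = "the_inv_into ?I f"
  let ?G = "qg_mean ?I f"
  have I: "is_interval ?I" by (rule is_interval_oi)
  have inj: "inj_on f ?I" by (rule strict_mono_on_imp_inj_on[OF f_mono])
  have fF: "f (?F z) = z" if "z \<in> f ` ?I" for z
    by (rule f_the_inv_into_f[OF inj that])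
  \<comment> \<open>The value for \<open>N\<close> is that for \<open>M\<close> with
    \<open>x\<close> and \<open>y\<close> exchanged, so one lemma covers both.\<close>
  have M_btw: "g y / g x * f x \<in> {min (f x) (f y)..max (f x) (f y)}"
    and N_btw: "g x / g y * f y \<in> {min (f x) (f y)..max (f x) (f y)}"
    if "0 < x" "0 < y" for x y
    using ratio_weighted_between(1)[of ?I f g x y] ratio_weighted_between(1)[of ?I f g y x]
      that f_pos g_pos g_mono fg_mono by (auto simp: min.commute max.commute)
  have M_btw': "g y / g x * f x \<in> {min (f x) (f y)<..<max (f x) (f y)}"
    and N_btw': "g x / g y * f y \<in> {min (f x) (f y)<..<max (f x) (f y)}"
    if "0 < x" "0 < y" "x \<noteq> y" for x y
    using ratio_weighted_between(2)[of ?I f g x y] ratio_weighted_between(2)[of ?I f g y x]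
      that f_pos g_pos g_mono fg_mono by (auto simp: min.commute max.commute)
  have M_im: "g y / g x * f x \<in> f ` ?I" and N_im: "g x / g y * f y \<in> f ` ?I"
    and G_im: "sqrt (f x * f y) \<in> f ` ?I" if "0 < x" "0 < y" for x y
    using that mem_image_between[OF I f_cont, of x y] M_btw N_btw
      sqrt_mult_between[OF f_pos f_pos] by auto
  have M_mean: "strict_mean_on ?I M"
    unfolding strict_mean_on_def mean_on_def
    by (intro conjI ballI impI; unfold greaterThan_iff; subst M_eq)
      (simp_all only: the_inv_into_between[OF f_mono] greaterThan_iff M_im M_btw M_btw' not_False_eq_True simp_thms)
  have N_mean: "strict_mean_on ?I N"
    unfolding strict_mean_on_def mean_on_def
    by (intro conjI ballI impI; unfold greaterThan_iff; subst N_eq)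
      (simp_all only: the_inv_into_between[OF f_mono] greaterThan_iff N_im N_btw N_btw' not_False_eq_True simp_thms)
  have G_mean: "mean_on ?I ?G"
    unfolding mean_on_def qg_mean_def
    by (intro ballI the_inv_into_between(1)[OF f_mono] G_im sqrt_mult_between f_pos)
      (simp_all only: greaterThan_iff)
  have M_pos: "0 < M x y" and N_pos: "0 < N x y" and G_pos: "0 < ?G x y" if "0 < x" "0 < y" for x y
    using mean_on_mem[OF _ I, of _ x y] that M_mean N_mean G_mean by (auto simp: strict_mean_on_def)
  have G_inv: "?G (M x y) (N x y) = ?G x y" if "0 < x" "0 < y" for x y
  proof -
    \<comment> \<open>\<open>?G\<close> depends on its arguments only through the product of their
      \<open>f\<close>-values, and in this product the two ratios of \<open>g\<close>
      cancel.\<close>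
    have "f (M x y) * f (N x y) = (g y / g x * f x) * (g x / g y * f y)"
      using that by (simp only: M_eq N_eq fF M_im N_im)
    also have "\<dots> = f x * f y"
      using that g_pos[of x] g_pos[of y] by simp
    finally show ?thesis by (simp add: qg_mean_def)
  qed
  have cont_coord: "continuous_on (?I \<times> ?I) (\<lambda>p. h (fst p))" "continuous_on (?I \<times> ?I) (\<lambda>p. h (snd p))"
    if "continuous_on ?I h" for h :: "real \<Rightarrow> real"
    by (rule continuous_on_compose2[OF that]; force intro: continuous_on_fst continuous_on_snd continuous_on_id)+
  have contF: "continuous_on (f ` ?I) ?F"
    by (rule continuous_on_the_inv_into_interval[OF I f_cont inj])
  have g_nz: "g x \<noteq> 0" if "0 < x" for x
    using g_pos[OF that] by simp
  have ratio: "continuous_on (?I \<times> ?I) (\<lambda>p. g (snd p) / g (fst p) * f (fst p))"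
    "continuous_on (?I \<times> ?I) (\<lambda>p. g (fst p) / g (snd p) * f (snd p))"
    by (intro continuous_on_mult continuous_on_divide cont_coord f_cont g_cont; auto simp: g_nz)+
  \<comment> \<open>Continuity of \<open>?F\<close> is known on the image of \<open>f\<close>, so
    composing requires these inclusions.\<close>
  have "(\<lambda>p. g (snd p) / g (fst p) * f (fst p)) ` (?I \<times> ?I) \<subseteq> f ` ?I"
    "(\<lambda>p. g (fst p) / g (snd p) * f (snd p)) ` (?I \<times> ?I) \<subseteq> f ` ?I"
    by (intro image_subsetI M_im N_im; simp add: mem_Times_iff)+
  then have "continuous_on (?I \<times> ?I)
      (\<lambda>p. (?F (g (snd p) / g (fst p) * f (fst p)), ?F (g (fst p) / g (snd p) * f (snd p))))"
    by (intro continuous_on_Pair continuous_on_compose2[OF contF ratio(1)]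
        continuous_on_compose2[OF contF ratio(2)])
  then have cont: "continuous_on (?I \<times> ?I) (pair_map M N)"
    by (rule continuous_on_eq) (auto simp: pair_map_def M_eq N_eq)
  \<comment> \<open>\<open>the_inv_into\<close> sees a function only through its values on
    \<open>?I\<close>. Hence it gives the same total function for \<open>f\<close> and for the
    products of \<open>f / g\<close> and \<open>g\<close>, which are known to equal \<open>f\<close>
    on the positive reals, where \<open>g\<close> does not vanish.\<close>
  have fg_eq: "the_inv_into ?I h = ?F" if "\<And>t. 0 < t \<Longrightarrow> h t = f t" for h
    using that by (simp add: the_inv_into_def fun_eq_iff cong: conj_cong)
  have M_gen: "M x y = gwqg_mean ?I (\<lambda>t. f t / g t) g x y"
    and N_gen: "N x y = gwqg_mean ?I g (\<lambda>t. f t / g t) x y" if "0 < x" "0 < y" for x y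
  proof -
    have "the_inv_into ?I (\<lambda>t. f t / g t * g t) = ?F" "the_inv_into ?I (\<lambda>t. g t * (f t / g t)) = ?F"
      by (rule fg_eq; simp add: g_nz)+
    then show "M x y = gwqg_mean ?I (\<lambda>t. f t / g t) g x y" "N x y = gwqg_mean ?I g (\<lambda>t. f t / g t) x y"
      using that by (simp_all add: gwqg_mean_def M_eq N_eq mult.commute)
  qed
  have cont_fg: "continuous_on ?I (\<lambda>t. f t / g t)"
    by (intro continuous_on_divide f_cont g_cont) (simp add: g_nz)
  have gen: "gwqg_generators ?I (\<lambda>t. f t / g t) g" "gwqg_generators ?I g (\<lambda>t. f t / g t)"
    using I cont_fg g_cont g_mono fg_mono f_pos g_pos by (auto simp: gwqg_generators_def)
  have inv: "\<And>x y. x \<in> ?I \<Longrightarrow> y \<in> ?I \<Longrightarrow> ?G (M x y) (N x y) = ?G x y"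
    by (simp add: G_inv)
  have lim: "uniform_limit K (\<lambda>n. pair_map M N ^^ n) (pair_map ?G ?G) sequentially"
    if "compact K" "K \<subseteq> ?I \<times> ?I" for K
    by (rule uniform_limit_mean_type_iterates[where M = M and N = N and G = ?G, OF I M_mean N_mean G_mean cont inv that])
  have \<Phi>: "(\<forall>x>0. \<forall>y>0. \<Phi> (M x y, N x y) = \<Phi> (x, y)) \<longleftrightarrow>
      (\<exists>\<phi>. continuous_on ?I \<phi> \<and> (\<forall>x>0. \<forall>y>0. \<Phi> (x, y) = \<phi> (?G x y)))"
    if "continuous_on (?I \<times> ?I) \<Phi>" for \<Phi> :: "real \<times> real \<Rightarrow> real"
    using invariant_iff_function_of_mean[where M = M and N = N and G = ?G, OF I M_mean N_mean G_mean cont inv that]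
    by (simp add: Ball_def)
  show ?thesis
    by (intro conjI allI impI M_im N_im G_im M_pos N_pos G_pos gen M_gen N_gen G_inv lim \<Phi>)
      simp_all
qed

end
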